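(* For any nonsingular matrix $M\in GL_n(\mathbb{R})$, the map $f:\mathcal{P}^n\times O_n\to GL_n(\mathbb{R})$ defined by $f(P,U)=PMU$ is a global diffeomorphism.
   Context: $\mathcal{P}^n$ is the set of symmetric positive-definite real $n\times n$ matrices (an open cone in the space of symmetric matrices), $O_n$ is the orthogonal group, and $GL_n(\mathbb{R})$ is the real general linear group, with their usual smooth manifold structures. *)

theory Defs
  imports "HOL-Analysis.Analysis"
begin

(* Meaningful for open S: continuity of f and of all its iterated directional
   derivatives up to order n, each obtained from a total derivative. *)
primrec cont_diff_on :: "nat \<Rightarrow> 'a::euclidean_space set \<Rightarrow> ('a \<Rightarrow> 'b::euclidean_space) \<Rightarrow> bool"
  where
    "cont_diff_on 0 S f \<longleftrightarrow> continuous_on S f"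
  | "cont_diff_on (Suc n) S f \<longleftrightarrow>
      (\<forall>x\<in>S. f differentiable (at x)) \<and>
      (\<forall>v. cont_diff_on n S (\<lambda>x. frechet_derivative f (at x) v))"

definition smooth_on_open :: "'a::euclidean_space set \<Rightarrow> ('a \<Rightarrow> 'b::euclidean_space) \<Rightarrow> bool"
  where "smooth_on_open S f \<longleftrightarrow> open S \<and> (\<forall>n. cont_diff_on n S f)"

(* Smoothness on an arbitrary subset X of a Euclidean space: near each point of X the
   map is the restriction of a smooth map defined on an open set of the ambient space.
   If X is an embedded submanifold (such as the symmetric positive-definite matrices,
   the orthogonal group, the general linear group and products of these, inside spaces
   of matrices), this is smoothness for the usual manifold structure of X. *)
definition smooth_map :: "'a::euclidean_space set \<Rightarrow> ('a \<Rightarrow> 'b::euclidean_space) \<Rightarrow> bool"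
  where "smooth_map X f \<longleftrightarrow>
    (\<forall>x\<in>X. \<exists>V g. x \<in> V \<and> smooth_on_open V g \<and> (\<forall>y\<in>X \<inter> V. g y = f y))"

definition diffeomorphism ::
    "'a::euclidean_space set \<Rightarrow> 'b::euclidean_space set \<Rightarrow> ('a \<Rightarrow> 'b) \<Rightarrow> bool"
  where "diffeomorphism X Y f \<longleftrightarrow>
    bij_betw f X Y \<and> smooth_map X f \<and> smooth_map Y (inv_into X f)"

definition pos_def_matrices :: "(real^'n^'n) set"
  where "pos_def_matrices = {P. transpose P = P \<and> (\<forall>x. x \<noteq> 0 \<longrightarrow> x \<bullet> (P *v x) > 0)}"

definition orthogonal_group :: "(real^'n^'n) set"
  where "orthogonal_group = {U. orthogonal_matrix U}"

definition general_linear_group :: "(real^'n^'n) set"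
  where "general_linear_group = {A. invertible A}"

end

theory Submission
  imports Defs
begin

text \<open>Multiplying \<open>A = P M U\<close> by \<open>transpose M\<close> turns it into the polar decomposition
  \<open>transpose M A = H U\<close> with \<open>H = transpose M P M\<close>, where \<open>H\<close> is the positive definite square root
  of \<open>(transpose M A) (transpose (transpose M A))\<close>. A polar decomposition exists because a
  maximiser \<open>V\<close> of the trace of \<open>C V\<close> over the compact orthogonal group makes \<open>C V\<close> symmetric
  and positive. Since \<open>(H - K) H + K (H - K) = H H - K K\<close> and the Sylvester operator
  \<open>W \<mapsto> W H + K W\<close> is coercive for positive definite \<open>H\<close> and \<open>K\<close>, the square root is unique and
  locally Lipschitz, hence differentiable; its smoothness, and that of \<open>U\<close>, follow by
  bootstrapping through linear systems with smooth coefficients.\<close>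

section \<open>Continuously differentiable maps\<close>

text \<open>Since \<open>S\<close> is open, the derivative at a point of \<open>S\<close> sees only
  values on \<open>S\<close>. This allows replacing \<open>frechet_derivative\<close>, at every
  level of the recursion, by any formula valid on \<open>S\<close>.\<close>

lemma cont_diff_on_cong:
  assumes "open S" "\<And>x. x \<in> S \<Longrightarrow> f x = g x" "cont_diff_on n S f"
  shows "cont_diff_on n S g"
  using assms(2,3)
proof (induction n arbitrary: f g)
  case 0
  then show ?case by (simp cong: continuous_on_cong)
next
  case (Suc n)
  have der: "(g has_derivative frechet_derivative f (at x)) (at x)" if "x \<in> S" for x
    using Suc.prems that frechet_derivative_works assms(1)
      has_derivative_transform_within_open[of f _ x UNIV S g]
    by fastforce
  then have "frechet_derivative g (at x) = frechet_derivative f (at x)" if "x \<in> S" for x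
    using that frechet_derivative_at by metis
  then have "cont_diff_on n S (\<lambda>x. frechet_derivative g (at x) v)" for v
    using Suc.IH[of "\<lambda>x. frechet_derivative f (at x) v"] Suc.prems by auto
  then show ?case
    using der by (auto intro: differentiableI)
qed

lemma cont_diff_on_SucI:
  assumes "open S" "\<And>x. x \<in> S \<Longrightarrow> (f has_derivative f' x) (at x)"
    and "\<And>v. cont_diff_on n S (\<lambda>x. f' x v)"
  shows "cont_diff_on (Suc n) S f"
proof -
  have "frechet_derivative f (at x) = f' x" if "x \<in> S" for x
    using assms(2)[OF that] frechet_derivative_at by metis
  then have "cont_diff_on n S (\<lambda>x. frechet_derivative f (at x) v)" for v
    using cont_diff_on_cong[OF assms(1) _ assms(3)] by simp
  then show ?thesis
    using assms(2) by (auto intro: differentiableI)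
qed

lemma cont_diff_on_SucD:
  assumes "cont_diff_on (Suc n) S f" "x \<in> S"
  shows "(f has_derivative frechet_derivative f (at x)) (at x)"
  using assms frechet_derivative_works by auto

lemma cont_diff_on_Suc_imp: "cont_diff_on (Suc n) S f \<Longrightarrow> cont_diff_on n S f"
proof (induction n arbitrary: f)
  case 0
  then show ?case
    by (simp add: continuous_at_imp_continuous_on differentiable_imp_continuous_within)
next
  case (Suc n)
  then show ?case by (metis cont_diff_on.simps(2))
qed

lemma cont_diff_on_const: "cont_diff_on n S (\<lambda>x. c)"
  by (induction n arbitrary: c) auto

lemma cont_diff_on_linear:
  assumes "linear f" "open S" "cont_diff_on n S g"
  shows "cont_diff_on n S (\<lambda>x. f (g x))"
  using assms(3)
proof (induction n arbitrary: g)
  case 0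
  then show ?case
    using assms(1) linear_continuous_on_compose by fastforce
next
  case (Suc n)
  have "((\<lambda>x. f (g x)) has_derivative (\<lambda>v. f (frechet_derivative g (at x) v))) (at x)"
    if "x \<in> S" for x
    using bounded_linear.has_derivative[OF _ cont_diff_on_SucD[OF Suc.prems that]] assms(1)
    by (simp add: linear_linear)
  then show ?case
    by (rule cont_diff_on_SucI[OF assms(2)]) (use Suc in auto)
qed

lemma cont_diff_on_ident: "open S \<Longrightarrow> cont_diff_on n S (\<lambda>x. x)"
proof (cases n)
  case (Suc m)
  assume "open S"
  then show ?thesis
    unfolding Suc by (rule cont_diff_on_SucI[where f' = "\<lambda>x v. v"]) (auto simp: cont_diff_on_const)
qed simp

lemma cont_diff_on_add:
  assumes "open S" "cont_diff_on n S f" "cont_diff_on n S g"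
  shows "cont_diff_on n S (\<lambda>x. f x + g x)"
  using assms(2,3)
proof (induction n arbitrary: f g)
  case 0
  then show ?case by (simp add: continuous_on_add)
next
  case (Suc n)
  show ?case
    by (rule cont_diff_on_SucI[OF assms(1) has_derivative_add[OF cont_diff_on_SucD cont_diff_on_SucD]])
      (use Suc in auto)
qed

lemma cont_diff_on_diff:
  assumes "open S" "cont_diff_on n S f" "cont_diff_on n S g"
  shows "cont_diff_on n S (\<lambda>x. f x - g x)"
  using cont_diff_on_add[OF assms(1,2) cont_diff_on_linear[OF _ assms(1,3), of uminus]]
  by (simp add: linear_iff)

lemma cont_diff_on_sum:
  assumes "open S" "\<And>i. i \<in> I \<Longrightarrow> cont_diff_on n S (f i)"
  shows "cont_diff_on n S (\<lambda>x. \<Sum>i\<in>I. f i x)"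
  using assms(2)
  by (induction I rule: infinite_finite_induct)
    (auto intro: cont_diff_on_const cont_diff_on_add[OF assms(1)])

lemma cont_diff_on_bilinear:
  assumes "bounded_bilinear h" "open S" "cont_diff_on n S f" "cont_diff_on n S g"
  shows "cont_diff_on n S (\<lambda>x. h (f x) (g x))"
  using assms(3,4)
proof (induction n arbitrary: f g)
  case 0
  then show ?case by (simp add: bounded_bilinear.continuous_on[OF assms(1)])
next
  case (Suc n)
  note fg = Suc.prems[THEN cont_diff_on_Suc_imp]
  show ?case
  proof (rule cont_diff_on_SucI[OF assms(2)
        bounded_bilinear.FDERIV[OF assms(1) cont_diff_on_SucD cont_diff_on_SucD]])
    show "cont_diff_on n S (\<lambda>x. h (f x) (frechet_derivative g (at x) v)
        + h (frechet_derivative f (at x) v) (g x))" for v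
      using Suc fg by (intro cont_diff_on_add[OF assms(2)]) auto
  qed (use Suc.prems in auto)
qed

text \<open>A differentiable map vanishing at \<open>a\<close> is O(|y - a|), so an extra factor
  tending to 0 makes the bound o(|y - a|). This serves for products with a merely continuous factor
  and for the quadratic remainder of the square root.\<close>

lemma has_derivative_zero_if_le_mult:
  assumes "(\<psi> has_derivative \<psi>') (at a)" "\<psi> a = 0" "(\<eta> \<longlongrightarrow> (0::real)) (at a)" "g a = 0"
    and le: "eventually (\<lambda>y. norm (g y) \<le> \<eta> y * norm (\<psi> y)) (at a)"
  shows "(g has_derivative (\<lambda>_. 0)) (at a)"
proof -
  have bl: "bounded_linear \<psi>'"
    using assms(1) by (rule has_derivative_bounded_linear)
  then obtain K where K: "\<And>v. norm (\<psi>' v) \<le> norm v * K"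
    using bounded_linear.bounded by blast
  have "((\<lambda>y. (1 / norm (y - a)) *\<^sub>R (\<psi> y - (\<psi> a + \<psi>' (y - a)))) \<longlongrightarrow> 0) (at a)"
    using assms(1) by (simp add: has_derivative_within)
  then have "eventually (\<lambda>y. norm ((1 / norm (y - a)) *\<^sub>R (\<psi> y - (\<psi> a + \<psi>' (y - a)))) < 1) (at a)"
    by (auto dest: tendstoD[where e = 1])
  moreover have "eventually (\<lambda>y. y \<noteq> a) (at a)"
    by (simp add: eventually_at_filter)
  \<comment> \<open>In \<open>K + 1\<close>, \<open>K\<close> bounds the operator
    \<open>\<psi>'\<close> and 1 bounds the remainder of \<open>\<psi>\<close> relative to
    \<open>norm (y - a)\<close>.\<close>
  ultimately have "eventually (\<lambda>y. norm ((1 / norm (y - a)) *\<^sub>R (g y - (g a + 0))) \<le> \<bar>\<eta> y\<bar> * (K + 1)) (at a)"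
    using le
  proof eventually_elim
    case (elim y)
    have pos: "norm (y - a) > 0"
      using elim by simp
    have "norm (\<psi> y - \<psi>' (y - a)) \<le> norm (y - a)"
      using elim(1) pos assms(2) by (simp add: divide_simps)
    then have "norm (\<psi> y) \<le> norm (y - a) * (K + 1)"
      using K[of "y - a"] norm_triangle_sub[of "\<psi> y" "\<psi>' (y - a)"] by (simp add: algebra_simps)
    then have "\<bar>\<eta> y\<bar> * norm (\<psi> y) \<le> \<bar>\<eta> y\<bar> * (norm (y - a) * (K + 1))"
      by (simp add: mult_left_mono)
    moreover have "norm (g y) \<le> \<bar>\<eta> y\<bar> * norm (\<psi> y)"
      using elim(3) by (meson abs_ge_self mult_right_mono norm_ge_zero order_trans)
    ultimately show ?case
      using pos assms(4) by (simp add: divide_simps mult_ac)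
  qed
  moreover have "((\<lambda>y. \<bar>\<eta> y\<bar> * (K + 1)) \<longlongrightarrow> 0) (at a)"
    using assms(3) by (intro tendsto_mult_left_zero tendsto_rabs_zero)
  ultimately have "((\<lambda>y. (1 / norm (y - a)) *\<^sub>R (g y - (g a + 0))) \<longlongrightarrow> 0) (at a)"
    by (rule Lim_null_comparison)
  then show ?thesis
    by (simp add: has_derivative_within)
qed

lemma linear_expand_Basis:
  fixes L :: "'a::euclidean_space \<Rightarrow> 'b::real_vector"
  assumes "linear L"
  shows "L w = (\<Sum>i\<in>Basis. (w \<bullet> i) *\<^sub>R L i)"
  using assms by (metis (no_types, lifting) euclidean_representation linear_scale linear_sum sum.cong)

section \<open>Solutions of linear systems\<close>

text \<open>Perturbation argument: \<open>L a\<close> is bounded below by some \<open>m > 0\<close>,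
  and once \<open>L x\<close> is within \<open>m / 2\<close> of it in operator norm, the error term
  in \<open>X x - X a\<close> can be absorbed on the left.\<close>

lemma linear_solution_continuous:
  fixes L :: "'a::euclidean_space \<Rightarrow> 'b::euclidean_space \<Rightarrow> 'b"
  assumes lin: "\<And>x. linear (L x)" and inj: "inj (L a)"
    and L: "\<And>w. isCont (\<lambda>x. L x w) a" and b: "isCont b a"
    and S: "open S" "a \<in> S" and eq: "\<And>x. x \<in> S \<Longrightarrow> L x (X x) = b x"
  shows "isCont X a"
proof -
  obtain m where m: "m > 0" "\<And>w. m * norm w \<le> norm (L a w)"
    using linear_inj_bounded_below_pos[OF lin inj] by blast
  \<comment> \<open>Summing over the finite basis bounds the operator norm of
    \<open>L x - L a\<close>, so continuity of each \<open>L x w\<close> in \<open>x\<close>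
    suffices.\<close>
  define \<epsilon> where "\<epsilon> x = (\<Sum>i\<in>Basis. norm (L x i - L a i))" for x
  have \<epsilon>: "norm (L x w - L a w) \<le> \<epsilon> x * norm w" for x w
  proof -
    have "L x w - L a w = (\<Sum>i\<in>Basis. (w \<bullet> i) *\<^sub>R (L x i - L a i))"
      by (simp add: linear_expand_Basis[OF lin, of _ w] sum_subtractf scaleR_right_diff_distrib)
    also have "norm \<dots> \<le> (\<Sum>i\<in>Basis. norm w * norm (L x i - L a i))"
      by (intro sum_norm_le) (simp add: Basis_le_norm mult_right_mono)
    finally show ?thesis
      by (simp add: \<epsilon>_def sum_distrib_left mult.commute)
  qed
  have "isCont \<epsilon> a"
    unfolding \<epsilon>_def using L by (intro continuous_intros) auto
  then have \<epsilon>0: "(\<epsilon> \<longlongrightarrow> 0) (at a)"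
    by (simp add: isCont_def \<epsilon>_def)
  have b0: "((\<lambda>x. b x - b a) \<longlongrightarrow> 0) (at a)"
    using b by (simp add: isCont_def LIM_zero_iff)
  have "eventually (\<lambda>x. x \<in> S) (at a)"
    using S by (rule eventually_at_in_open')
  moreover have "eventually (\<lambda>x. \<epsilon> x < m / 2) (at a)"
    using order_tendstoD(2)[OF \<epsilon>0, of "m / 2"] m(1) by simp
  ultimately have
    "eventually (\<lambda>x. norm (X x - X a) \<le> 2 / m * (norm (b x - b a) + \<epsilon> x * norm (X a))) (at a)"
  proof eventually_elim
    case (elim x)
    have "L a (X x - X a) = (b x - b a) - (L x (X x) - L a (X x))"
      using eq S(2) elim(1) by (simp add: linear_diff[OF lin])
    then have "m * norm (X x - X a) \<le> norm ((b x - b a) - (L x (X x) - L a (X x)))"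
      using m(2)[of "X x - X a"] by simp
    also have "\<dots> \<le> norm (b x - b a) + \<epsilon> x * norm (X x)"
      using \<epsilon>[of x "X x"] norm_triangle_ineq4[of "b x - b a" "L x (X x) - L a (X x)"] by linarith
    also have "\<epsilon> x * norm (X x) \<le> \<epsilon> x * (norm (X a) + norm (X x - X a))"
      using norm_triangle_sub[of "X x" "X a"]
      by (intro mult_left_mono) (auto simp: \<epsilon>_def intro: sum_nonneg)
    also have "\<dots> \<le> \<epsilon> x * norm (X a) + m / 2 * norm (X x - X a)"
      using mult_right_mono[of "\<epsilon> x" "m / 2" "norm (X x - X a)"] elim(2)
      by (simp add: algebra_simps)
    finally show ?case
      using m(1) by (simp add: field_simps)
  qed
  moreover have "((\<lambda>x. 2 / m * (norm (b x - b a) + \<epsilon> x * norm (X a))) \<longlongrightarrow> 0) (at a)"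
    by (intro tendsto_mult_right_zero tendsto_add_zero tendsto_mult_left_zero tendsto_norm_zero b0 \<epsilon>0)
  ultimately show ?thesis
    unfolding isCont_def LIM_zero_iff[symmetric, of X] by (rule Lim_null_comparison)
qed

text \<open>A product rule with a merely continuous factor: as \<open>\<psi>\<close> vanishes at
  \<open>a\<close>, replacing \<open>\<phi> x\<close> by \<open>\<phi> a\<close> costs only a term
  of smaller order.\<close>

lemma has_derivative_scaleR_vanishing:
  assumes "isCont \<phi> a" "(\<psi> has_derivative \<psi>') (at a)" "\<psi> a = 0"
  shows "((\<lambda>x. \<phi> x *\<^sub>R \<psi> x) has_derivative (\<lambda>v. \<phi> a *\<^sub>R \<psi>' v)) (at a)"
proof -
  have "((\<lambda>x. (\<phi> x - \<phi> a) *\<^sub>R \<psi> x) has_derivative (\<lambda>_. 0)) (at a)"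
  proof (rule has_derivative_zero_if_le_mult[OF assms(2,3)])
    show "((\<lambda>x. \<bar>\<phi> x - \<phi> a\<bar>) \<longlongrightarrow> 0) (at a)"
      using assms(1) by (simp add: isCont_def LIM_zero tendsto_rabs_zero)
  qed (auto simp: assms(3))
  from has_derivative_add[OF this has_derivative_scaleR_right[OF assms(2), of "\<phi> a"]]
  show ?thesis
    by (simp add: algebra_simps)
qed

text \<open>Freezing the operator at \<open>a\<close> gives \<open>L a (X x - X a) = R x\<close>. In
  \<open>R\<close>, the merely continuous coordinates of \<open>X\<close> only multiply differences
  \<open>L x i - L a i\<close> that vanish at \<open>a\<close>, so \<open>R\<close> is
  differentiable, and a linear left inverse of \<open>L a\<close> recovers \<open>X\<close>.\<close>

lemma linear_solution_differentiable:
  fixes L :: "'a::euclidean_space \<Rightarrow> 'b::euclidean_space \<Rightarrow> 'b"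
  assumes lin: "\<And>x. linear (L x)" and inj: "inj (L a)"
    and L: "\<And>w. (\<lambda>x. L x w) differentiable (at a)" and b: "b differentiable (at a)"
    and S: "open S" "a \<in> S" and eq: "\<And>x. x \<in> S \<Longrightarrow> L x (X x) = b x"
  shows "X differentiable (at a)"
proof -
  have "isCont X a"
    by (rule linear_solution_continuous[where L = L and b = b and S = S])
      (use assms in \<open>auto intro: differentiable_imp_continuous_within\<close>)
  then have coord: "isCont (\<lambda>x. X x \<bullet> i) a" for i
    by (intro continuous_intros)
  define R where "R x = b x - b a - (\<Sum>i\<in>Basis. (X x \<bullet> i) *\<^sub>R (L x i - L a i))" for x
  have "(\<lambda>x. (X x \<bullet> i) *\<^sub>R (L x i - L a i)) differentiable (at a)" for i
  proof -
    obtain D where "((\<lambda>x. L x i) has_derivative D) (at a)"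
      using L[of i] unfolding differentiable_def by (elim exE)
    from has_derivative_diff[OF this has_derivative_const[of "L a i"]]
    have "((\<lambda>x. L x i - L a i) has_derivative D) (at a)"
      by simp
    then have "((\<lambda>x. (X x \<bullet> i) *\<^sub>R (L x i - L a i)) has_derivative (\<lambda>v. (X a \<bullet> i) *\<^sub>R D v)) (at a)"
      by (rule has_derivative_scaleR_vanishing[OF coord]) simp
    then show ?thesis
      by (rule differentiableI)
  qed
  then have "R differentiable (at a)"
    unfolding R_def using b by (intro differentiable_diff differentiable_sum differentiable_const) auto
  then obtain D where R: "(R has_derivative D) (at a)"
    unfolding differentiable_def by (elim exE)
  obtain g where g: "linear g" "g \<circ> L a = id"
    using linear_injective_left_inverse[OF lin[of a] inj] by (elim exE conjE)
  have "((\<lambda>x. X a + g (R x)) has_derivative (\<lambda>v. 0 + g (D v))) (at a)"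
    by (intro has_derivative_add has_derivative_const bounded_linear.has_derivative[OF _ R])
      (simp add: g(1) linear_linear)
  moreover have "X a + g (R x) = X x" if "x \<in> S" for x
  proof -
    have "(\<Sum>i\<in>Basis. (X x \<bullet> i) *\<^sub>R (L x i - L a i)) = L x (X x) - L a (X x)"
      by (simp add: linear_expand_Basis[OF lin, of _ "X x"] sum_subtractf scaleR_right_diff_distrib)
    then have "R x = L a (X x - X a)"
      using eq that S(2) by (simp add: R_def linear_diff[OF lin])
    then show ?thesis
      using fun_cong[OF g(2), of "X x - X a"] by simp
  qed
  ultimately have "(X has_derivative (\<lambda>v. 0 + g (D v))) (at a)"
    by (rule has_derivative_transform_within_open[OF _ S])
  then show ?thesis
    by (rule differentiableI)
qed

text \<open>Differentiating \<open>L x (X x) = b x\<close> shows that each directional derivative of \<open>X\<close> solves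
  a linear system with the same operator \<open>L x\<close>, so the regularity of \<open>X\<close> can be bootstrapped.\<close>

lemma cont_diff_on_linear_solution:
  fixes L :: "'a::euclidean_space \<Rightarrow> 'b::euclidean_space \<Rightarrow> 'b"
  assumes lin: "\<And>x. linear (L x)" and inj: "\<And>x. x \<in> S \<Longrightarrow> inj (L x)" and S: "open S"
    and L: "\<And>w. cont_diff_on n S (\<lambda>x. L x w)" and b: "cont_diff_on n S b"
    and eq: "\<And>x. x \<in> S \<Longrightarrow> L x (X x) = b x"
  shows "cont_diff_on n S X"
  using L b eq
proof (induction n arbitrary: b X)
  case 0
  have "isCont X a" if "a \<in> S" for a
    by (rule linear_solution_continuous[where L = L and b = b and S = S])
      (use 0 that lin inj S in \<open>auto simp: continuous_on_eq_continuous_at[OF S]\<close>)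
  then show ?case
    by (simp add: continuous_on_eq_continuous_at[OF S])
next
  case (Suc n)
  let ?D = "\<lambda>f x. frechet_derivative f (at x)"
  note lower = cont_diff_on_Suc_imp[OF Suc.prems(1)]
  have X: "cont_diff_on n S X"
    by (rule Suc.IH[of b]) (use lower cont_diff_on_Suc_imp[OF Suc.prems(2)] Suc.prems(3) in auto)
  have dX: "(X has_derivative ?D X x) (at x)" if "x \<in> S" for x
  proof -
    have "X differentiable (at x)"
      by (rule linear_solution_differentiable[where L = L and b = b and S = S])
        (use lin inj that S Suc.prems in auto)
    then show ?thesis
      by (simp add: frechet_derivative_works)
  qed
  have "cont_diff_on n S (\<lambda>x. ?D X x v)" for v
  \<comment> \<open>Second use of the induction hypothesis, now for the directional derivative as
    unknown. The new right-hand side \<open>?b\<close> involves \<open>X\<close> but not its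
    derivative, so the regularity \<open>n\<close> just obtained for \<open>X\<close> is
    enough.\<close>
  proof (rule Suc.IH[OF lower])
    let ?b = "\<lambda>x. ?D b x v - (\<Sum>i\<in>Basis. (X x \<bullet> i) *\<^sub>R ?D (\<lambda>x. L x i) x v)"
    have "cont_diff_on n S (\<lambda>x. X x \<bullet> i)" for i
      by (rule cont_diff_on_linear[OF _ S X]) (simp add: linear_iff inner_left_distrib)
    then have "cont_diff_on n S (\<lambda>x. (X x \<bullet> i) *\<^sub>R ?D (\<lambda>x. L x i) x v)" for i
      using Suc.prems(1) by (intro cont_diff_on_bilinear[OF bounded_bilinear_scaleR S]) auto
    then show "cont_diff_on n S ?b"
      using Suc.prems(2) by (intro cont_diff_on_diff[OF S] cont_diff_on_sum[OF S]) auto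
    fix x assume x: "x \<in> S"
    have "((\<lambda>x. \<Sum>i\<in>Basis. (X x \<bullet> i) *\<^sub>R L x i) has_derivative
        (\<lambda>v. \<Sum>i\<in>Basis. (X x \<bullet> i) *\<^sub>R ?D (\<lambda>x. L x i) x v + (?D X x v \<bullet> i) *\<^sub>R L x i)) (at x)"
      by (intro has_derivative_sum has_derivative_scaleR has_derivative_inner_left dX x
          cont_diff_on_SucD[OF Suc.prems(1)])
    moreover have "(\<Sum>i\<in>Basis. (X y \<bullet> i) *\<^sub>R L y i) = b y" if "y \<in> S" for y
      using linear_expand_Basis[OF lin, of y "X y"] Suc.prems(3)[OF that] by simp
    ultimately have "(b has_derivative
        (\<lambda>v. \<Sum>i\<in>Basis. (X x \<bullet> i) *\<^sub>R ?D (\<lambda>x. L x i) x v + (?D X x v \<bullet> i) *\<^sub>R L x i)) (at x)"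
      using has_derivative_transform_within_open[OF _ S x] by blast
    then have "?D b x =
        (\<lambda>v. \<Sum>i\<in>Basis. (X x \<bullet> i) *\<^sub>R ?D (\<lambda>x. L x i) x v + (?D X x v \<bullet> i) *\<^sub>R L x i)"
      by (rule frechet_derivative_at[symmetric])
    then show "L x (?D X x v) = ?b x"
      using linear_expand_Basis[OF lin, of x "?D X x v"] by (simp add: sum.distrib)
  qed
  then show ?case
    using cont_diff_on_SucI[OF S dX] by blast
qed

section \<open>Positive definite square roots\<close>

lemma bounded_bilinear_matrix_mult:
  "bounded_bilinear ((**) :: real^'n^'m \<Rightarrow> real^'p^'n \<Rightarrow> real^'p^'m)"
  unfolding bilinear_conv_bounded_bilinear[symmetric] bilinear_def linear_iff
  by (auto simp: vec_eq_iff matrix_matrix_mult_def algebra_simps sum.distrib sum_distrib_left)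

lemmas matrix_mult_diff_right = bounded_bilinear.diff_right[OF bounded_bilinear_matrix_mult]
lemmas matrix_mult_diff_left = bounded_bilinear.diff_left[OF bounded_bilinear_matrix_mult]

lemma linear_matrix_mult_left: "linear (\<lambda>X::real^'p^'n. (A::real^'n^'m) ** X)"
  by (rule bounded_linear.linear[OF bounded_bilinear.bounded_linear_right[OF bounded_bilinear_matrix_mult]])

lemma linear_matrix_mult_right: "linear (\<lambda>X::real^'n^'m. X ** (A::real^'p^'n))"
  by (rule bounded_linear.linear[OF bounded_bilinear.bounded_linear_left[OF bounded_bilinear_matrix_mult]])

lemma linear_transpose: "linear (transpose :: real^'n^'m \<Rightarrow> real^'m^'n)"
  by (auto simp: linear_iff transpose_def vec_eq_iff)

lemma inner_transpose: "transpose A \<bullet> transpose B = A \<bullet> (B :: real^'n^'m)"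
  unfolding inner_vec_def transpose_def by (simp, rule sum.swap)

text \<open>The rows of \<open>W ** transpose H\<close> are \<open>H\<close> applied to the rows of
  \<open>W\<close>. This reduces positivity of an operator on matrices to positivity of quadratic
  forms on vectors.\<close>

lemma inner_matrix_mult_transpose:
  "W \<bullet> (W ** transpose H) = (\<Sum>i\<in>UNIV. W $ i \<bullet> ((H::real^'n^'n) *v W $ i))"
  by (simp add: inner_vec_def matrix_matrix_mult_def matrix_vector_mult_def transpose_def mult.commute)

section \<open>Coercivity of positive definite matrices and of the Sylvester operator\<close>

lemma pos_def_matrices_nonneg: "P \<in> pos_def_matrices \<Longrightarrow> 0 \<le> x \<bullet> (P *v x)"
  unfolding pos_def_matrices_def by (cases "x = 0") (auto intro: less_imp_le)

lemma pos_def_matrices_invertible: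
  assumes "P \<in> pos_def_matrices"
  shows "invertible P"
proof -
  have "x = 0" if "P *v x = 0" for x
    using assms that by (force simp: pos_def_matrices_def)
  then show ?thesis
    by (simp add: invertible_left_inverse matrix_left_invertible_ker)
qed

text \<open>By compactness the quadratic form attains a minimum on the unit sphere, which is
  positive; homogeneity extends the bound to all vectors.\<close>

lemma pos_def_matrices_coercive:
  fixes P :: "real^'n^'n"
  assumes "P \<in> pos_def_matrices"
  obtains m where "m > 0" "\<And>x. m * (x \<bullet> x) \<le> x \<bullet> (P *v x)"
proof -
  have "continuous_on (sphere 0 1) (\<lambda>x::real^'n. x \<bullet> (P *v x))"
    by (intro continuous_intros matrix_vector_mult_linear_continuous_on)
  moreover have "sphere (0::real^'n) 1 \<noteq> {}"
    by simp
  ultimately obtain u :: "real^'n" where u: "u \<in> sphere 0 1"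
    and min: "\<And>x. x \<in> sphere 0 1 \<Longrightarrow> u \<bullet> (P *v u) \<le> x \<bullet> (P *v x)"
    using continuous_attains_inf[OF compact_sphere[of "0::real^'n" 1]] by blast
  have "u \<bullet> (P *v u) * (x \<bullet> x) \<le> x \<bullet> (P *v x)" for x
  proof (cases "x = 0")
    case False
    have "u \<bullet> (P *v u) \<le> (x /\<^sub>R norm x) \<bullet> (P *v (x /\<^sub>R norm x))"
      using False by (intro min) simp
    also have "\<dots> = x \<bullet> (P *v x) / (x \<bullet> x)"
      by (simp add: matrix_vector_mult_scaleR dot_square_norm power2_eq_square divide_inverse)
    finally show ?thesis
      using False by (simp add: field_simps)
  qed simp
  moreover have "u \<bullet> (P *v u) > 0"
    using u assms norm_eq_zero[of u] by (auto simp: pos_def_matrices_def)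
  ultimately show thesis
    using that by blast
qed

text \<open>Pair \<open>W ** H + K ** W\<close> with \<open>W\<close>: the first term contributes a
  nonnegative amount, the second at least \<open>m\<close> times the squared norm, and
  Cauchy-Schwarz finishes. As \<open>m\<close> depends on \<open>K\<close> alone, the bound is
  uniform in \<open>H\<close>, which the Lipschitz estimate for a varying square root
  requires.\<close>

lemma sylvester_bounded_below:
  fixes K :: "real^'n^'n"
  assumes "K \<in> pos_def_matrices"
  shows "\<exists>m>0. \<forall>H\<in>pos_def_matrices. \<forall>W::real^'n^'n. m * norm W \<le> norm (W ** H + K ** W)"
proof -
  obtain m where m: "m > 0" "\<And>x. m * (x \<bullet> x) \<le> x \<bullet> (K *v x)"
    using pos_def_matrices_coercive[OF assms] by blast
  have "m * norm W \<le> norm (W ** H + K ** W)" if H: "H \<in> pos_def_matrices"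
    for H W :: "real^'n^'n"
  proof (cases "W = 0")
    case False
    have "transpose H = H" "transpose K = K"
      using H assms by (auto simp: pos_def_matrices_def)
    have "0 \<le> W \<bullet> (W ** H)"
      using inner_matrix_mult_transpose[of W H] pos_def_matrices_nonneg[OF H] \<open>transpose H = H\<close>
      by (simp add: sum_nonneg)
    \<comment> \<open>Transposing turns the left factor \<open>K\<close> into a right factor, so
      that the row formula applies.\<close>
    have "m * (W \<bullet> W) = m * (transpose W \<bullet> transpose W)"
      by (simp add: inner_transpose)
    also have "\<dots> \<le> transpose W \<bullet> (transpose W ** transpose K)"
      unfolding inner_matrix_mult_transpose inner_vec_def[of "transpose W" "transpose W"] sum_distrib_left
      by (intro sum_mono m(2))
    also have "\<dots> = W \<bullet> (K ** W)"
      using inner_transpose[of W "K ** W"] by (simp add: matrix_transpose_mul)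
    finally have "m * (norm W)\<^sup>2 \<le> W \<bullet> (W ** H + K ** W)"
      using \<open>0 \<le> W \<bullet> (W ** H)\<close> by (simp add: inner_add_right dot_square_norm)
    also have "\<dots> \<le> norm W * norm (W ** H + K ** W)"
      by (rule norm_cauchy_schwarz)
    finally show ?thesis
      using False by (simp add: power2_eq_square)
  qed simp
  with m(1) show ?thesis
    by blast
qed

lemma diff_matrix_square:
  fixes H K :: "real^'n^'n"
  shows "(H - K) ** H + K ** (H - K) = H ** H - K ** K"
  by (simp add: matrix_mult_diff_right matrix_mult_diff_left)

lemma pos_def_square_inject:
  fixes H K :: "real^'n^'n"
  assumes "H \<in> pos_def_matrices" "K \<in> pos_def_matrices" "H ** H = K ** K"
  shows "H = K"
proof -
  obtain m where m: "m > 0"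
    "\<forall>H\<in>pos_def_matrices. \<forall>W::real^'n^'n. m * norm W \<le> norm (W ** H + K ** W)"
    using sylvester_bounded_below[OF assms(2)] by (elim exE conjE)
  have "m * norm (H - K) \<le> 0"
    using m(2)[rule_format, OF assms(1), of "H - K"] unfolding diff_matrix_square assms(3) by simp
  then show ?thesis
    using m(1) by (simp add: mult_le_0_iff)
qed

lemma linear_sylvester:
  fixes H K :: "real^'n^'n"
  shows "linear (\<lambda>W::real^'n^'n. W ** H + K ** W)"
  by (intro linear_compose_add linear_matrix_mult_left linear_matrix_mult_right)

lemma inj_sylvester:
  fixes H K :: "real^'n^'n"
  assumes "H \<in> pos_def_matrices" "K \<in> pos_def_matrices"
  shows "inj (\<lambda>W::real^'n^'n. W ** H + K ** W)"
proof -
  obtain m where m: "m > 0"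
    "\<forall>H\<in>pos_def_matrices. \<forall>W::real^'n^'n. m * norm W \<le> norm (W ** H + K ** W)"
    using sylvester_bounded_below[OF assms(2)] by (elim exE conjE)
  have "W = 0" if "W ** H + K ** W = 0" for W :: "real^'n^'n"
    using m(2)[rule_format, OF assms(1), of W] m(1) by (simp add: that mult_le_0_iff)
  then show ?thesis
    unfolding linear_injective_0[OF linear_sylvester] by blast
qed

section \<open>Regularity of the positive definite square root\<close>

lemma pos_def_sqrt_lipschitz:
  fixes H :: "'a \<Rightarrow> real^'n^'n"
  assumes "a \<in> S" and H: "\<And>x. x \<in> S \<Longrightarrow> H x \<in> pos_def_matrices"
    and eq: "\<And>x. x \<in> S \<Longrightarrow> H x ** H x = B x"
  shows "\<exists>m>0. \<forall>x\<in>S. m * norm (H x - H a) \<le> norm (B x - B a)"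
proof -
  obtain m where m: "m > 0"
    "\<forall>K\<in>pos_def_matrices. \<forall>W::real^'n^'n. m * norm W \<le> norm (W ** K + H a ** W)"
    using sylvester_bounded_below[OF H[OF assms(1)]] by (elim exE conjE)
  have "m * norm (H x - H a) \<le> norm (B x - B a)" if "x \<in> S" for x
    using m(2)[rule_format, OF H[OF that], of "H x - H a"]
    unfolding diff_matrix_square eq[OF that] eq[OF assms(1)] .
  with m(1) show ?thesis
    by blast
qed

lemma pos_def_sqrt_continuous:
  fixes H :: "'a::euclidean_space \<Rightarrow> real^'n^'n"
  assumes S: "open S" "a \<in> S" and H: "\<And>x. x \<in> S \<Longrightarrow> H x \<in> pos_def_matrices"
    and eq: "\<And>x. x \<in> S \<Longrightarrow> H x ** H x = B x" and B: "isCont B a"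
  shows "isCont H a"
proof -
  have "\<exists>m>0. \<forall>x\<in>S. m * norm (H x - H a) \<le> norm (B x - B a)"
    by (rule pos_def_sqrt_lipschitz[OF S(2) H eq])
  then obtain m where m: "m > 0" "\<forall>x\<in>S. m * norm (H x - H a) \<le> norm (B x - B a)"
    by (elim exE conjE)
  have "((\<lambda>x. norm (B x - B a) / m) \<longlongrightarrow> 0) (at a)"
    using B by (intro tendsto_divide_zero tendsto_norm_zero) (simp add: isCont_def LIM_zero)
  moreover have "eventually (\<lambda>x. norm (H x - H a) \<le> norm (B x - B a) / m) (at a)"
    using eventually_at_in_open'[OF S]
  proof eventually_elim
    case (elim x)
    then have "m * norm (H x - H a) \<le> norm (B x - B a)"
      using m(2) by blast
    then show ?case
      using m(1) by (simp add: pos_le_divide_eq mult.commute)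
  qed
  ultimately have "((\<lambda>x. H x - H a) \<longlongrightarrow> 0) (at a)"
    by (rule Lim_null_comparison[rotated])
  then show ?thesis
    by (simp add: isCont_def LIM_zero_iff)
qed

text \<open>With \<open>W = H x - H a\<close>, the difference \<open>B x - B a\<close> is the
  Sylvester operator at \<open>H a\<close> applied to \<open>W\<close>, plus \<open>W ** W\<close>.
  The Lipschitz estimate and continuity of \<open>H\<close> make \<open>W ** W\<close> of smaller
  order, and a left inverse of the Sylvester operator gives the derivative.\<close>

lemma pos_def_sqrt_differentiable:
  fixes H :: "'a::euclidean_space \<Rightarrow> real^'n^'n"
  assumes S: "open S" "a \<in> S" and H: "\<And>x. x \<in> S \<Longrightarrow> H x \<in> pos_def_matrices"
    and eq: "\<And>x. x \<in> S \<Longrightarrow> H x ** H x = B x" and B: "B differentiable (at a)"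
  shows "H differentiable (at a)"
proof -
  have "\<exists>m>0. \<forall>x\<in>S. m * norm (H x - H a) \<le> norm (B x - B a)"
    by (rule pos_def_sqrt_lipschitz[OF S(2) H eq])
  then obtain m where m: "m > 0" "\<forall>x\<in>S. m * norm (H x - H a) \<le> norm (B x - B a)"
    by (elim exE conjE)
  have cont: "isCont H a"
    by (rule pos_def_sqrt_continuous[OF S H eq differentiable_imp_continuous_within[OF B]])
  obtain K where K: "\<And>X Y. norm ((X::real^'n^'n) ** (Y::real^'n^'n)) \<le> norm X * norm Y * K" "K > 0"
    using bounded_bilinear.pos_bounded[OF bounded_bilinear_matrix_mult[where 'n = 'n and 'm = 'n and 'p = 'n]] by blast
  obtain D where "(B has_derivative D) (at a)"
    using B unfolding differentiable_def by (elim exE)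
  then have D: "((\<lambda>x. B x - B a) has_derivative D) (at a)"
    by (auto intro!: derivative_eq_intros)
  have Y: "((\<lambda>x. (H x - H a) ** (H x - H a)) has_derivative (\<lambda>_. 0)) (at a)"
  proof (rule has_derivative_zero_if_le_mult[OF D])
    show "((\<lambda>x. norm (H x - H a) * K / m) \<longlongrightarrow> 0) (at a)"
      using cont by (intro tendsto_divide_zero tendsto_mult_left_zero tendsto_norm_zero)
        (simp add: isCont_def LIM_zero)
    show "eventually (\<lambda>x. norm ((H x - H a) ** (H x - H a))
        \<le> norm (H x - H a) * K / m * norm (B x - B a)) (at a)"
      using eventually_at_in_open'[OF S]
    proof eventually_elim
      case (elim x)
      have "norm ((H x - H a) ** (H x - H a)) \<le> norm (H x - H a) * K / m * (m * norm (H x - H a))"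
        using K(1)[of "H x - H a" "H x - H a"] m(1) by (simp add: mult_ac)
      also have "\<dots> \<le> norm (H x - H a) * K / m * norm (B x - B a)"
        using m elim K(2) by (intro mult_left_mono) auto
      finally show ?case .
    qed
  qed (auto simp: matrix_mult_diff_left)
  obtain g where g: "linear g" "g \<circ> (\<lambda>W::real^'n^'n. W ** H a + H a ** W) = id"
    using linear_injective_left_inverse[OF linear_sylvester inj_sylvester[OF H H, OF S(2) S(2)]]
    by (elim exE conjE)
  have "((\<lambda>x. H a + g (B x - B a - (H x - H a) ** (H x - H a))) has_derivative
      (\<lambda>v. 0 + g (D v - 0))) (at a)"
    by (intro has_derivative_add has_derivative_const
        bounded_linear.has_derivative[OF _ has_derivative_diff[OF D Y]])
      (simp add: g(1) linear_linear)
  moreover have "H a + g (B x - B a - (H x - H a) ** (H x - H a)) = H x" if "x \<in> S" for x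
  proof -
    have "B x - B a - (H x - H a) ** (H x - H a) = (H x - H a) ** H a + H a ** (H x - H a)"
      using eq[OF that] eq[OF S(2)] by (simp add: matrix_mult_diff_left matrix_mult_diff_right)
    then show ?thesis
      using fun_cong[OF g(2), of "H x - H a"] by simp
  qed
  ultimately have "(H has_derivative (\<lambda>v. 0 + g (D v - 0))) (at a)"
    by (rule has_derivative_transform_within_open[OF _ S])
  then show ?thesis
    by (rule differentiableI)
qed

text \<open>Differentiating \<open>H x ** H x = B x\<close> yields a Sylvester equation for the
  derivative of \<open>H\<close>, with coefficients built from \<open>H\<close> itself; each round
  of linear-system regularity therefore gains one order for \<open>H\<close>.\<close>

lemma cont_diff_on_pos_def_sqrt:
  fixes H :: "'a::euclidean_space \<Rightarrow> real^'n^'n"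
  assumes S: "open S" and H: "\<And>x. x \<in> S \<Longrightarrow> H x \<in> pos_def_matrices"
    and eq: "\<And>x. x \<in> S \<Longrightarrow> H x ** H x = B x" and B: "cont_diff_on n S B"
  shows "cont_diff_on n S H"
  using B
proof (induction n)
  case 0
  have "isCont H a" if "a \<in> S" for a
  proof (rule pos_def_sqrt_continuous[OF S that H eq])
    show "isCont B a"
      using 0 that by (simp add: continuous_on_eq_continuous_at[OF S])
  qed
  then show ?case
    by (simp add: continuous_on_eq_continuous_at[OF S])
next
  case (Suc n)
  let ?D = "\<lambda>f x. frechet_derivative f (at x)"
  have IH: "cont_diff_on n S H"
    using Suc cont_diff_on_Suc_imp by blast
  have dH: "(H has_derivative ?D H x) (at x)" if "x \<in> S" for x
    
  proof -
    have "H differentiable (at x)"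
      by (rule pos_def_sqrt_differentiable[OF S that H eq]) (use Suc.prems that in auto)
    then show ?thesis
      by (simp add: frechet_derivative_works)
  qed
  have "cont_diff_on n S (\<lambda>x. ?D H x v)" for v
  proof (rule cont_diff_on_linear_solution[where L = "\<lambda>x (W::real^'n^'n). W ** H x + H x ** W" and b = "\<lambda>x. ?D B x v"])
    show "cont_diff_on n S (\<lambda>x. W ** H x + H x ** W)" for W :: "real^'n^'n"
      by (intro cont_diff_on_add[OF S] cont_diff_on_linear[OF _ S IH]
          linear_matrix_mult_left linear_matrix_mult_right)
    show "?D H x v ** H x + H x ** ?D H x v = ?D B x v" if "x \<in> S" for x
    proof -
      have "(B has_derivative (\<lambda>v. H x ** ?D H x v + ?D H x v ** H x)) (at x)"
        by (rule has_derivative_transform_within_open[OF _ S that eq])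
          (intro bounded_bilinear.FDERIV[OF bounded_bilinear_matrix_mult] dH that)
      then have "?D B x = (\<lambda>v. H x ** ?D H x v + ?D H x v ** H x)"
        by (rule frechet_derivative_at[symmetric])
      then show ?thesis
        by (simp add: add.commute)
    qed
  qed (use S H Suc.prems in \<open>auto intro: linear_sylvester inj_sylvester\<close>)
  then show ?case
    by (intro cont_diff_on_SucI[OF S dH])
qed

section \<open>Polar decomposition\<close>

lemma linear_term_zero_if_quadratic_nonneg:
  fixes a b :: real
  assumes "\<And>t. 0 \<le> t * a + t\<^sup>2 * b"
  shows "a = 0"
proof (rule ccontr)
  assume "a \<noteq> 0"
  \<comment> \<open>Any positive \<open>c > b\<close> serves: at \<open>t = - a / c\<close> the
    quadratic equals \<open>(a / c)\<^sup>2 * (b - c)\<close>, which is negative.\<close>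
  define c where "c = \<bar>b\<bar> + 1"
  have c: "c > 0" "b < c"
    by (auto simp: c_def)
  have "0 \<le> (- a / c) * a + (- a / c)\<^sup>2 * b"
    by (rule assms)
  also have "\<dots> = (a / c)\<^sup>2 * (b - c)"
    using c(1) by (simp add: field_simps power2_eq_square)
  also have "\<dots> < 0"
    using c \<open>a \<noteq> 0\<close> by (intro mult_pos_neg) auto
  finally show False
    by simp
qed

section \<open>Reflections and orthogonal maximisers of the trace\<close>

definition outer_product :: "real^'n \<Rightarrow> real^'n \<Rightarrow> real^'n^'n"
  where "outer_product x y = (\<chi> i j. x $ i * y $ j)"

lemma outer_product_vector: "outer_product x y *v z = (y \<bullet> z) *\<^sub>R x"
  by (simp add: vec_eq_iff outer_product_def matrix_vector_mult_def inner_vec_def sum_distrib_left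
      mult_ac)

lemma transpose_outer_product: "transpose (outer_product x y) = outer_product y x"
  by (simp add: vec_eq_iff outer_product_def transpose_def mult.commute)

lemma trace_mult_outer_product: "trace (A ** outer_product x y) = y \<bullet> (A *v x)"
  by (simp add: trace_def outer_product_def matrix_matrix_mult_def matrix_vector_mult_def
      inner_vec_def sum_distrib_left mult_ac)

text \<open>The Householder reflection in the hyperplane orthogonal to \<open>x\<close>, for
  \<open>x\<close> of any nonzero length.\<close>

definition reflection :: "real^'n \<Rightarrow> real^'n^'n"
  where "reflection x = mat 1 - (2 / (x \<bullet> x)) *\<^sub>R outer_product x x"

lemma reflection_vector: "reflection x *v y = y - (2 * (x \<bullet> y) / (x \<bullet> x)) *\<^sub>R x"
  by (simp add: reflection_def matrix_vector_mult_diff_rdistrib scaleR_matrix_vector_assoc[symmetric]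
      outer_product_vector)

lemma transpose_reflection: "transpose (reflection x) = reflection x"
  by (simp add: reflection_def linear_diff[OF linear_transpose] linear_scale[OF linear_transpose]
      transpose_outer_product)

lemma orthogonal_matrix_reflection:
  assumes "x \<noteq> 0"
  shows "orthogonal_matrix (reflection x)"
proof -
  have "reflection x *v (reflection x *v y) = y" for y
    using assms by (simp add: reflection_vector inner_diff_right)
  then have "reflection x ** reflection x = mat 1"
    by (simp add: matrix_eq matrix_vector_mul_assoc[symmetric])
  then show ?thesis
    by (simp add: orthogonal_matrix_def transpose_reflection)
qed

lemma trace_mult_reflection:
  fixes A :: "real^'n^'n"
  shows "trace (A ** reflection x) = trace A - 2 / (x \<bullet> x) * (x \<bullet> (A *v x))"
proof -
  have "trace (c *\<^sub>R B) = c * trace B" for c and B :: "real^'n^'n"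
    by (simp add: trace_def sum_distrib_left)
  then show ?thesis
    by (simp add: reflection_def matrix_mult_diff_right trace_sub
        bounded_bilinear.scaleR_right[OF bounded_bilinear_matrix_mult] trace_mult_outer_product)
qed

text \<open>Multiplying by the reflection along \<open>x\<close> lowers the trace by a positive
  multiple of the quadratic form at \<open>x\<close>, so a negative value would contradict
  maximality.\<close>

lemma trace_maximal_nonneg:
  fixes H :: "real^'n^'n"
  assumes "\<And>W. orthogonal_matrix W \<Longrightarrow> trace (H ** W) \<le> trace H"
  shows "0 \<le> x \<bullet> (H *v x)"
proof (cases "x = 0")
  case False
  then have "x \<bullet> x > 0"
    by simp
  then show ?thesis
    using assms[OF orthogonal_matrix_reflection[OF False]]
    by (simp add: trace_mult_reflection zero_le_divide_iff del: inner_gt_zero_iff)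
qed simp

text \<open>The product of the reflections along \<open>x\<close> and \<open>x + t z\<close> is a rotation in the plane of
  \<open>x\<close> and \<open>z\<close>; the first-order term in \<open>t\<close> of the trace is the antisymmetric part of \<open>H\<close>.\<close>

lemma trace_maximal_symmetric:
  fixes H :: "real^'n^'n"
  assumes max: "\<And>W. orthogonal_matrix W \<Longrightarrow> trace (H ** W) \<le> trace H"
  shows "transpose H = H"
proof -
  have sym: "x \<bullet> (H *v z) = z \<bullet> (H *v x)"
    if xz: "x \<bullet> x = 1" "z \<bullet> z = 1" "x \<bullet> z = 0" for x z
  proof -
    let ?a = "x \<bullet> (H *v x)" and ?b = "x \<bullet> (H *v z)" and ?c = "z \<bullet> (H *v x)"
      and ?d = "z \<bullet> (H *v z)"
    \<comment> \<open>This quadratic is \<open>(1 + t\<^sup>2) / 2\<close> times the loss of trace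
      caused by the two reflections; being nonnegative for every \<open>t\<close>, it has no linear
      term.\<close>
    have "0 \<le> t * (?b - ?c) + t\<^sup>2 * (?a + ?d)" for t
    proof -
      define y where "y = x + t *\<^sub>R z"
      have yy: "y \<bullet> y = 1 + t\<^sup>2"
        using xz by (simp add: y_def inner_add_left inner_add_right inner_commute[of z x]
            power2_eq_square)
      then have pos: "y \<bullet> y > 0"
        by (simp add: add_pos_nonneg)
      have "reflection x *v y = t *\<^sub>R z - x"
        using xz by (simp add: reflection_vector y_def inner_add_right scaleR_2)
      then have "(H ** reflection x) *v y = H *v (t *\<^sub>R z - x)"
        by (simp add: matrix_vector_mul_assoc[symmetric])
      then have q: "y \<bullet> ((H ** reflection x) *v y) = t * (?b - ?c) - ?a + t\<^sup>2 * ?d"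
        by (simp only:) (simp add: y_def power2_eq_square algebra_simps)
      have "x \<noteq> 0" "y \<noteq> 0"
        using xz pos by auto
      then have "trace (H ** (reflection x ** reflection y)) \<le> trace H"
        by (intro max orthogonal_matrix_mul orthogonal_matrix_reflection)
      moreover have "trace (H ** (reflection x ** reflection y))
          = trace H - 2 * ?a - 2 * ((t * (?b - ?c) - ?a + t\<^sup>2 * ?d) / (1 + t\<^sup>2))"
        unfolding matrix_mul_assoc trace_mult_reflection[of _ y] trace_mult_reflection[of H] q yy
        using xz(1) by simp
      ultimately have "0 \<le> ?a + (t * (?b - ?c) - ?a + t\<^sup>2 * ?d) / (1 + t\<^sup>2)"
        by linarith
      also have "\<dots> = (t * (?b - ?c) + t\<^sup>2 * (?a + ?d)) / (1 + t\<^sup>2)"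
        using pos unfolding yy by (simp add: field_simps)
      finally show ?thesis
        using pos unfolding yy by (simp add: zero_le_divide_iff)
    qed
    then show ?thesis
      using linear_term_zero_if_quadratic_nonneg by fastforce
  qed
  have entry: "H $ i $ j = axis i 1 \<bullet> (H *v axis j 1)" for i j
    by (simp add: inner_axis' matrix_vector_mult_basis column_def)
  \<comment> \<open>Distinct axis vectors are orthonormal, so \<open>sym\<close> applies to every
    off-diagonal entry.\<close>
  have "H $ i $ j = H $ j $ i" for i j
    using sym[of "axis i 1" "axis j 1"] by (cases "i = j") (auto simp: entry inner_axis_axis)
  then show ?thesis
    by (simp add: vec_eq_iff transpose_def)
qed

text \<open>All orthogonal matrices have the same Frobenius norm, and they form the preimage of a
  point under a continuous map.\<close>

lemma compact_orthogonal_group: "compact (orthogonal_group :: (real^'n^'n) set)"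
proof (rule compact_eq_bounded_closed[THEN iffD2], rule conjI)
  have "norm U = sqrt (real CARD('n))" if "orthogonal_matrix U" for U :: "real^'n^'n"
  proof -
    have "U \<bullet> U = trace (U ** transpose U)"
      by (simp add: trace_def inner_vec_def matrix_matrix_mult_def transpose_def)
    then show ?thesis
      using that by (simp add: orthogonal_matrix_def norm_eq_sqrt_inner trace_I)
  qed
  then show "bounded (orthogonal_group :: (real^'n^'n) set)"
    unfolding bounded_iff orthogonal_group_def by (metis mem_Collect_eq order_refl)
  have "continuous_on UNIV (\<lambda>U::real^'n^'n. transpose U ** U)"
    by (intro bounded_bilinear.continuous_on[OF bounded_bilinear_matrix_mult]
        linear_continuous_on continuous_on_id) (simp add: linear_linear linear_transpose)
  moreover have "orthogonal_group = {U::real^'n^'n. transpose U ** U = mat 1}"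
    by (simp add: orthogonal_group_def orthogonal_matrix)
  ultimately show "closed (orthogonal_group :: (real^'n^'n) set)"
    using continuous_closed_preimage_constant[of UNIV "\<lambda>U::real^'n^'n. transpose U ** U" "mat 1"]
    by simp
qed

text \<open>If the form vanishes at \<open>x\<close>, then \<open>x\<close> minimises it, so the
  first-order condition in every direction \<open>y\<close> gives \<open>H *v x = 0\<close>, which
  invertibility excludes.\<close>

lemma pos_def_matricesI:
  fixes H :: "real^'n^'n"
  assumes H: "transpose H = H" "\<And>x. 0 \<le> x \<bullet> (H *v x)" "invertible H"
  shows "H \<in> pos_def_matrices"
proof -
  have "0 < x \<bullet> (H *v x)" if "x \<noteq> 0" for x
  proof (rule ccontr)
    assume "\<not> 0 < x \<bullet> (H *v x)"
    then have zero: "x \<bullet> (H *v x) = 0"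
      using H(2)[of x] by simp
    have sym: "x \<bullet> (H *v y) = y \<bullet> (H *v x)" for y
      using dot_lmul_matrix[of x H y] H(1) transpose_matrix_vector[of H x]
      by (simp add: inner_commute)
    have "y \<bullet> (H *v x) = 0" for y
    proof -
      have "0 \<le> t * (2 * (y \<bullet> (H *v x))) + t\<^sup>2 * (y \<bullet> (H *v y))" for t
        using H(2)[of "x + t *\<^sub>R y"]
        by (simp add: zero sym[of y] power2_eq_square algebra_simps)
      then show ?thesis
        using linear_term_zero_if_quadratic_nonneg by fastforce
    qed
    then have "H *v x = 0"
      by (metis inner_eq_zero_iff)
    then show False
      using H(3) that by (simp add: invertible_left_inverse matrix_left_invertible_ker)
  qed
  then show ?thesis
    using H(1) by (simp add: pos_def_matrices_def)
qed

lemma orthogonal_matrix_invertible: "orthogonal_matrix U \<Longrightarrow> invertible U"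
  unfolding orthogonal_matrix_def invertible_def by blast

lemma polar_decomposition_exists:
  fixes C :: "real^'n^'n"
  assumes "invertible C"
  obtains H U where "H \<in> pos_def_matrices" "U \<in> orthogonal_group" "C = H ** U"
proof -
  have "continuous_on orthogonal_group (\<lambda>V::real^'n^'n. trace (C ** V))"
    unfolding trace_def matrix_matrix_mult_def by (auto intro!: continuous_intros)
  moreover have "mat 1 \<in> (orthogonal_group :: (real^'n^'n) set)"
    by (simp add: orthogonal_group_def orthogonal_matrix_id)
  then have "(orthogonal_group :: (real^'n^'n) set) \<noteq> {}"
    by blast
  ultimately obtain V :: "real^'n^'n" where V: "V \<in> orthogonal_group"
    and V_max: "\<forall>W\<in>orthogonal_group. trace (C ** W) \<le> trace (C ** V)"
    using continuous_attains_sup[OF compact_orthogonal_group] by blast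
  \<comment> \<open>\<open>V ** W\<close> competes with \<open>V\<close>, so \<open>C ** V\<close>
    satisfies the maximality hypothesis of the two trace lemmas.\<close>
  have max: "trace (C ** V ** W) \<le> trace (C ** V)" if "orthogonal_matrix W" for W
    using V_max V that orthogonal_matrix_mul[of V W]
    by (simp add: orthogonal_group_def matrix_mul_assoc[symmetric])
  have "invertible (C ** V)"
    using assms V orthogonal_matrix_invertible by (auto simp: orthogonal_group_def intro: invertible_mult)
  then have "C ** V \<in> pos_def_matrices"
    using trace_maximal_symmetric[OF max] trace_maximal_nonneg[OF max] by (intro pos_def_matricesI)
  moreover have "transpose V \<in> orthogonal_group"
    using V by (simp add: orthogonal_group_def)
  moreover have "C = C ** V ** transpose V"
    using V by (simp add: orthogonal_group_def orthogonal_matrix_def matrix_mul_assoc[symmetric])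
  ultimately show thesis
    by (rule that)
qed

text \<open>The orthogonal factor cancels, so the product \<open>H ** U\<close> alone determines the
  square of \<open>H\<close>.\<close>

lemma polar_square:
  assumes "H \<in> pos_def_matrices" "U \<in> orthogonal_group"
  shows "(H ** U) ** transpose (H ** U) = H ** H"
proof -
  have "(H ** U) ** transpose (H ** U) = H ** (U ** transpose U) ** transpose H"
    by (simp add: matrix_transpose_mul matrix_mul_assoc)
  then show ?thesis
    using assms by (simp add: pos_def_matrices_def orthogonal_group_def orthogonal_matrix_def)
qed

text \<open>The new form at \<open>x\<close> is the form of \<open>P\<close> at
  \<open>A *v x\<close>. With \<open>A = M\<close> this passes from \<open>P\<close> to the polar
  factor; with the inverse of \<open>M\<close> it passes back.\<close>

lemma pos_def_congruence:
  fixes A :: "real^'n^'n"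
  assumes "P \<in> pos_def_matrices" "invertible A"
  shows "transpose A ** P ** A \<in> pos_def_matrices"
proof (rule pos_def_matricesI)
  show "transpose (transpose A ** P ** A) = transpose A ** P ** A"
    using assms(1) by (simp add: pos_def_matrices_def matrix_transpose_mul matrix_mul_assoc)
  show "0 \<le> x \<bullet> ((transpose A ** P ** A) *v x)" for x
  proof -
    have "x \<bullet> ((transpose A ** P ** A) *v x) = (A *v x) \<bullet> (P *v (A *v x))"
      by (metis dot_lmul_matrix matrix_vector_mul_assoc transpose_matrix_vector transpose_transpose)
    then show ?thesis
      using pos_def_matrices_nonneg[OF assms(1)] by simp
  qed
  show "invertible (transpose A ** P ** A)"
    by (intro invertible_mult[OF invertible_mult] transpose_invertible
        pos_def_matrices_invertible[OF assms(1)] assms(2))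
qed

section \<open>The parametrisation of the general linear group\<close>

lemma open_general_linear_group: "open (general_linear_group :: (real^'n^'n) set)"
proof -
  have "continuous_on UNIV (det :: real^'n^'n \<Rightarrow> real)"
    unfolding det_def by (intro continuous_intros)
  then have "open {A :: real^'n^'n. det A \<noteq> 0}"
    by (intro open_Collect_neq) auto
  then show ?thesis
    by (simp add: general_linear_group_def invertible_det_nz)
qed

lemma congruence_cancel:
  fixes M N X :: "real^'n^'n"
  assumes "M ** N = mat 1"
  shows "transpose N ** (transpose M ** X ** M) ** N = X"
proof -
  have "transpose N ** transpose M = mat 1"
    using assms by (metis matrix_transpose_mul transpose_mat)
  moreover have "transpose N ** (transpose M ** X ** M) ** N
      = (transpose N ** transpose M) ** X ** (M ** N)"
    by (simp only: matrix_mul_assoc)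
  ultimately show ?thesis
    using assms by simp
qed

lemma bij_betw_pos_def_orthogonal:
  fixes M :: "real^'n^'n"
  assumes M: "invertible M"
  shows "bij_betw (\<lambda>(P, U). P ** M ** U) (pos_def_matrices \<times> orthogonal_group)
    general_linear_group"
proof (rule bij_betw_imageI)
  obtain N where N: "M ** N = mat 1" "N ** M = mat 1"
    using M unfolding invertible_def by blast
  have N': "invertible N"
    using N unfolding invertible_def by blast
  have tN: "transpose N ** transpose M = mat 1"
    by (simp add: N transpose_mat flip: matrix_transpose_mul)
  have gl: "invertible (P ** M ** U)"
    if "P \<in> pos_def_matrices" "U \<in> orthogonal_group" for P U
    using that(2) unfolding orthogonal_group_def mem_Collect_eq
    by (rule invertible_mult[OF invertible_mult[OF pos_def_matrices_invertible[OF that(1)] M]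
          orthogonal_matrix_invertible])
  show "inj_on (\<lambda>(P, U). P ** M ** U) (pos_def_matrices \<times> orthogonal_group)"
  proof (rule inj_onI, clarify)
    fix P Q U V
    assume P: "P \<in> pos_def_matrices" and Q: "Q \<in> pos_def_matrices"
      and U: "U \<in> orthogonal_group" and V: "V \<in> orthogonal_group"
      and eq: "P ** M ** U = Q ** M ** V"
    have "(transpose M ** P ** M) ** U = (transpose M ** Q ** M) ** V"
      using arg_cong[OF eq, of "(**) (transpose M)"] by (simp add: matrix_mul_assoc)
    then have "transpose M ** P ** M = transpose M ** Q ** M"
      using polar_square[OF pos_def_congruence[OF P M] U] polar_square[OF pos_def_congruence[OF Q M] V]
      by (intro pos_def_square_inject[OF pos_def_congruence[OF P M] pos_def_congruence[OF Q M]]) simp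
    then have "transpose N ** (transpose M ** P ** M) ** N
        = transpose N ** (transpose M ** Q ** M) ** N"
      by simp
    then have PQ: "P = Q"
      unfolding congruence_cancel[OF N(1)] .
    have "invertible (P ** M)"
      by (rule invertible_mult[OF pos_def_matrices_invertible[OF P] M])
    then obtain L where L: "L ** (P ** M) = mat 1"
      unfolding invertible_def by blast
    have "L ** (P ** M) ** U = L ** (P ** M) ** V"
      using eq PQ by (simp add: matrix_mul_assoc[symmetric])
    then show "P = Q \<and> U = V"
      using L PQ by simp
  qed
  show "(\<lambda>(P, U). P ** M ** U) ` (pos_def_matrices \<times> orthogonal_group) = general_linear_group"
  proof
    show "general_linear_group \<subseteq> (\<lambda>(P, U). P ** M ** U) ` (pos_def_matrices \<times> orthogonal_group)"
    proof
      fix A :: "real^'n^'n"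
      assume "A \<in> general_linear_group"
      then have "invertible (transpose M ** A)"
        using M by (intro invertible_mult transpose_invertible) (auto simp: general_linear_group_def)
      then obtain H U where HU: "H \<in> pos_def_matrices" "U \<in> orthogonal_group"
        "transpose M ** A = H ** U"
        using polar_decomposition_exists by blast
      \<comment> \<open>The preimage comes from solving \<open>H = transpose M ** P ** M\<close> for
        \<open>P\<close>.\<close>
      have "transpose N ** H ** N ** M ** U = transpose N ** H ** (N ** M) ** U"
        by (simp only: matrix_mul_assoc)
      also have "\<dots> = transpose N ** (H ** U)"
        by (simp add: N matrix_mul_assoc)
      also have "\<dots> = (transpose N ** transpose M) ** A"
        by (simp only: HU(3)[symmetric] matrix_mul_assoc)
      also have "\<dots> = A"
        by (simp add: tN)
      finally have "A = (\<lambda>(P, U). P ** M ** U) (transpose N ** H ** N, U)"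
        by simp
      then show "A \<in> (\<lambda>(P, U). P ** M ** U) ` (pos_def_matrices \<times> orthogonal_group)"
        using pos_def_congruence[OF HU(1) N'] HU(2) by blast
    qed
  qed (auto simp: general_linear_group_def gl)
qed

text \<open>Formulated for arbitrary factors satisfying the equation, so that the components of
  \<open>inv_into\<close> can be inserted. The congruence of \<open>P A\<close> by \<open>M\<close>
  is the square root of a polynomial in \<open>A\<close>, and then \<open>U A\<close> solves a
  linear system with operator \<open>W \<mapsto> P A ** M ** W\<close>.\<close>

lemma smooth_on_open_polar_inverse:
  fixes M :: "real^'n^'n" and P U :: "real^'n^'n \<Rightarrow> real^'n^'n"
  assumes M: "invertible M"
    and P: "\<And>A. A \<in> general_linear_group \<Longrightarrow> P A \<in> pos_def_matrices"
    and U: "\<And>A. A \<in> general_linear_group \<Longrightarrow> U A \<in> orthogonal_group"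
    and eq: "\<And>A. A \<in> general_linear_group \<Longrightarrow> P A ** M ** U A = A"
  shows "smooth_on_open general_linear_group (\<lambda>A. (P A, U A))"
  unfolding smooth_on_open_def
proof (intro conjI allI)
  show S: "open (general_linear_group :: (real^'n^'n) set)"
    by (rule open_general_linear_group)
  fix n
  obtain N where N: "M ** N = mat 1"
    using M unfolding invertible_def by blast
  let ?B = "\<lambda>A. (transpose M ** A) ** transpose (transpose M ** A)"
  have C: "cont_diff_on n general_linear_group (\<lambda>A. transpose M ** A)"
    by (rule cont_diff_on_linear[OF linear_matrix_mult_left S cont_diff_on_ident[OF S]])
  have "cont_diff_on n general_linear_group (\<lambda>A. transpose M ** P A ** M)"
  proof (rule cont_diff_on_pos_def_sqrt[OF S])
    show "cont_diff_on n general_linear_group ?B"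
      by (intro cont_diff_on_bilinear[OF bounded_bilinear_matrix_mult S C]
          cont_diff_on_linear[OF linear_transpose S C])
    fix A :: "real^'n^'n"
    assume A: "A \<in> general_linear_group"
    show PD: "transpose M ** P A ** M \<in> pos_def_matrices"
      by (rule pos_def_congruence[OF P[OF A] M])
    have "(transpose M ** P A ** M) ** U A = transpose M ** A"
      using arg_cong[OF eq[OF A], of "(**) (transpose M)"] by (simp only: matrix_mul_assoc)
    then show "(transpose M ** P A ** M) ** (transpose M ** P A ** M) = ?B A"
      using polar_square[OF PD U[OF A]] by simp
  qed
  then have "cont_diff_on n general_linear_group
      (\<lambda>A. transpose N ** (transpose M ** P A ** M) ** N)"
    by (rule cont_diff_on_linear[OF linear_matrix_mult_right S
          cont_diff_on_linear[OF linear_matrix_mult_left S]])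
  then have smooth_P: "cont_diff_on n general_linear_group P"
    unfolding congruence_cancel[OF N] .
  have smooth_U: "cont_diff_on n general_linear_group U"
  proof (rule cont_diff_on_linear_solution[where L = "\<lambda>A W. P A ** M ** W" and b = "\<lambda>A. A"])
    show "cont_diff_on n general_linear_group (\<lambda>A. P A ** M ** W)" for W
      by (intro cont_diff_on_linear[OF linear_matrix_mult_right S] smooth_P)
    fix A :: "real^'n^'n"
    assume A: "A \<in> general_linear_group"
    have "invertible (P A ** M)"
      by (rule invertible_mult[OF pos_def_matrices_invertible[OF P[OF A]] M])
    then obtain L where "L ** (P A ** M) = mat 1"
      unfolding invertible_def by blast
    then have "L ** (P A ** M ** W) = W" for W
      by (simp add: matrix_mul_assoc)
    then show "inj (\<lambda>W. P A ** M ** W)"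
      by (rule inj_on_inverseI)
  qed (auto intro: linear_matrix_mult_left S cont_diff_on_ident eq)
  have "linear (\<lambda>X. (X, 0))" "linear (\<lambda>X. (0, X))"
    by (simp_all add: linear_iff)
  from cont_diff_on_add[OF S cont_diff_on_linear[OF this(1) S smooth_P]
      cont_diff_on_linear[OF this(2) S smooth_U]]
  show "cont_diff_on n general_linear_group (\<lambda>A. (P A, U A))"
    by simp
qed

theorem lemma2p4:
  fixes M :: "real^'n^'n"
  assumes "M \<in> general_linear_group"
  shows "diffeomorphism (pos_def_matrices \<times> orthogonal_group) general_linear_group
           (\<lambda>(P, U). P ** M ** U)"
proof -
  let ?X = "pos_def_matrices \<times> orthogonal_group :: ((real^'n^'n) \<times> (real^'n^'n)) set"
  let ?f = "\<lambda>(P, U). P ** M ** U"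
  let ?g = "inv_into ?X ?f"
  have M: "invertible M"
    using assms by (simp add: general_linear_group_def)
  have bij: "bij_betw ?f ?X general_linear_group"
    by (rule bij_betw_pos_def_orthogonal[OF M])
  \<comment> \<open>The formula is polynomial in the entries, so one extension to the whole ambient
    space witnesses smoothness at every point.\<close>
  have "cont_diff_on n UNIV (\<lambda>x::(real^'n^'n) \<times> (real^'n^'n). fst x ** M ** snd x)" for n
    by (intro cont_diff_on_bilinear[OF bounded_bilinear_matrix_mult]
        cont_diff_on_linear[OF linear_matrix_mult_right] cont_diff_on_linear[OF linear_fst]
        cont_diff_on_linear[OF linear_snd] cont_diff_on_ident open_UNIV)
  then have f: "smooth_map ?X ?f"
    unfolding smooth_map_def smooth_on_open_def case_prod_unfold
    by (intro ballI exI[of _ UNIV] exI[of _ "\<lambda>x. fst x ** M ** snd x"]) simp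
  have g: "?g A \<in> ?X" "?f (?g A) = A" if "A \<in> general_linear_group" for A
    using that bij inv_into_into[of A ?f ?X] f_inv_into_f[of A ?f ?X] by (simp_all add: bij_betw_def)
  have "smooth_on_open general_linear_group (\<lambda>A. (fst (?g A), snd (?g A)))"
    by (rule smooth_on_open_polar_inverse[OF M])
      (use g in \<open>simp_all only: case_prod_unfold mem_Times_iff\<close>)
  then have "smooth_map general_linear_group ?g"
    unfolding smooth_map_def prod.collapse by blast
  with bij f show ?thesis
    by (simp add: diffeomorphism_def)
qed

end
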